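(* Let $1\le p<+\infty$ and let $\sigma$ be a non-decreasing sigmoidal function satisfying: $\sigma(x)-1/2$ is odd; $\sigma\in C^2(\mathbb{R})$ is concave for $x\ge 0$; and $\sigma(x)=\mathcal{O}(|x|^{-1-\alpha})$ as $x\to-\infty$ for some $\alpha>p$. Let $N,M$ be positive integers and let $\widetilde f:[0,N]\times[0,M]\to\mathbb{R}$ be a digital image function, i.e. $\widetilde f=\sum_{i=1}^N\sum_{j=1}^M F_{i,j}\chi_{i,j}$ with $F_{i,j}\in\{0,1,\dots,255\}$. Then, for $0<\nu<\alpha$ and $0<\theta<1$, there is a constant $K_2>0$, independent of $n$ and $\widetilde f$, such that for $n\in\mathbb{N}^+$ $$\|F_n(\widetilde f,\cdot)-\widetilde f(\cdot)\|_p\ \le\ 255\,(2^{p-1}MN)^{1/p}\left(\frac{K_2}{n^{\nu(1-\theta)/p}}+\frac{8^{1/p}}{n^{\theta/p}}\right).$$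
   Context: A sigmoidal function is $\sigma:\mathbb{R}\to\mathbb{R}$ with $\lim_{x\to-\infty}\sigma(x)=0$ and $\lim_{x\to+\infty}\sigma(x)=1$. $\mathbb{N}^+$ is the set of positive integers. Let $I=[0,N]\times[0,M]$. For $1\le i\le N$, $1\le j\le M$, $\chi_{i,j}$ is the characteristic function of the unit pixel which is the product of $[i-1,i)$ (closed on the right if $i=N$) and $[j-1,j)$ (closed on the right if $j=M$); these pixels partition $I$. Set $\phi_\sigma(x)=\frac12[\sigma(x+1)-\sigma(x-1)]$ for $x\in\mathbb{R}$, $\Psi_\sigma(\mathtt{x})=\phi_\sigma(x_1)\phi_\sigma(x_2)$ for $\mathtt{x}=(x_1,x_2)\in\mathbb{R}^2$, and $\mathcal{A}_n=\{\mathtt{k}\in\mathbb{Z}^2:0\le k_1\le nN,\ 0\le k_2\le nM\}$. The neural network operators are $$F_n(f,\mathtt{x})=\frac{\sum_{\mathtt{k}\in\mathcal{A}_n}f(\mathtt{k}/n)\,\Psi_\sigma(n\mathtt{x}-\mathtt{k})}{\sum_{\mathtt{k}\in\mathcal{A}_n}\Psi_\sigma(n\mathtt{x}-\mathtt{k})},\qquad \mathtt{x}\in I,\ \mathtt{k}/n=(k_1/n,k_2/n).$$ $\|\cdot\|_p$ is the $L^p(I)$-norm with respect to Lebesgue measure. *)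

theory Defs
  imports "HOL-Analysis.Analysis" "HOL-Library.Landau_Symbols"
begin

definition sigmoidal :: "(real \<Rightarrow> real) \<Rightarrow> bool" where
  "sigmoidal \<sigma> \<longleftrightarrow> (\<sigma> \<longlongrightarrow> 0) at_bot \<and> (\<sigma> \<longlongrightarrow> 1) at_top"

definition odd_function :: "(real \<Rightarrow> real) \<Rightarrow> bool" where
  "odd_function g \<longleftrightarrow> (\<forall>x. g (- x) = - g x)"

definition C2_real :: "(real \<Rightarrow> real) \<Rightarrow> bool" where
  "C2_real g \<longleftrightarrow> (\<exists>g' g''. (\<forall>x. (g has_real_derivative g' x) (at x)) \<and>
     (\<forall>x. (g' has_real_derivative g'' x) (at x)) \<and> continuous_on UNIV g'')"

definition image_domain :: "nat \<Rightarrow> nat \<Rightarrow> (real \<times> real) set" where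
  "image_domain N M = {0..real N} \<times> {0..real M}"

definition pixel_side :: "nat \<Rightarrow> nat \<Rightarrow> real set" where
  "pixel_side N i = (if i = N then {real i - 1..real i} else {real i - 1..<real i})"

definition pixel :: "nat \<Rightarrow> nat \<Rightarrow> nat \<Rightarrow> nat \<Rightarrow> (real \<times> real) set" where
  "pixel N M i j = pixel_side N i \<times> pixel_side M j"

text \<open>A function on the rectangle is represented by a total function on the plane whose
  values off the rectangle are irrelevant; hence the restriction to the domain below.\<close>

definition digital_image :: "nat \<Rightarrow> nat \<Rightarrow> (real \<times> real \<Rightarrow> real) \<Rightarrow> bool" where
  "digital_image N M f \<longleftrightarrow> (\<exists>F :: nat \<Rightarrow> nat \<Rightarrow> nat.
     (\<forall>i\<in>{1..N}. \<forall>j\<in>{1..M}. F i j \<in> {0..255}) \<and>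
     (\<forall>x\<in>image_domain N M.
        f x = (\<Sum>i=1..N. \<Sum>j=1..M. real (F i j) * indicator (pixel N M i j) x)))"

definition phi :: "(real \<Rightarrow> real) \<Rightarrow> real \<Rightarrow> real" where
  "phi \<sigma> x = (1 / 2) * (\<sigma> (x + 1) - \<sigma> (x - 1))"

definition Psi :: "(real \<Rightarrow> real) \<Rightarrow> real \<times> real \<Rightarrow> real" where
  "Psi \<sigma> x = phi \<sigma> (fst x) * phi \<sigma> (snd x)"

definition nn_grid :: "nat \<Rightarrow> nat \<Rightarrow> nat \<Rightarrow> (int \<times> int) set" where
  "nn_grid N M n = {(k1, k2). 0 \<le> k1 \<and> k1 \<le> int (n * N) \<and> 0 \<le> k2 \<and> k2 \<le> int (n * M)}"

definition nn_operator ::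
  "(real \<Rightarrow> real) \<Rightarrow> nat \<Rightarrow> nat \<Rightarrow> nat \<Rightarrow> (real \<times> real \<Rightarrow> real) \<Rightarrow> real \<times> real \<Rightarrow> real" where
  "nn_operator \<sigma> N M n f x =
     (\<Sum>(k1, k2)\<in>nn_grid N M n. f (real_of_int k1 / real n, real_of_int k2 / real n) *
        Psi \<sigma> (real n * fst x - real_of_int k1, real n * snd x - real_of_int k2)) /
     (\<Sum>(k1, k2)\<in>nn_grid N M n.
        Psi \<sigma> (real n * fst x - real_of_int k1, real n * snd x - real_of_int k2))"

text \<open>The Bochner integral is 0 on non-integrable functions, so the norm is given the value
  infinity off the space of p-integrable functions; a finite upper bound on it therefore
  includes membership in that space.\<close>

definition Lp_norm :: "real \<Rightarrow> (real \<times> real) set \<Rightarrow> (real \<times> real \<Rightarrow> real) \<Rightarrow> ennreal" where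
  "Lp_norm p S g =
     (if g \<in> borel_measurable (lebesgue_on S) \<and>
         integrable (lebesgue_on S) (\<lambda>x. \<bar>g x\<bar> powr p)
      then ennreal ((integral\<^sup>L (lebesgue_on S) (\<lambda>x. \<bar>g x\<bar> powr p)) powr (1 / p))
      else \<infinity>)"

end

theory Submission
  imports Defs
begin

text \<open>The operator is a weighted average of the values of \<open>f\<close> at the grid points \<open>k/n\<close>, and a
  digital image is constant on each pixel. Its error at \<open>x\<close> is therefore caused only by the weight
  of the grid points outside the pixel of \<open>x\<close>. Fix \<open>\<delta> = n powr (- \<theta>)\<close> and split the rectangle.

  If \<open>x\<close> is further than \<open>\<delta>\<close> from all pixel edges, the offending grid points satisfy
  \<open>\<bar>n x\<^sub>i - k\<^sub>i\<bar> \<ge> n \<delta>\<close> in some coordinate \<open>i\<close>. Because \<open>phi\<close> is a difference of two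
  translates of \<open>\<sigma>\<close>, sums of \<open>phi (y - k)\<close> over consecutive integers telescope
  (\<open>sum_phi_telescope\<close>). The two tails beyond distance \<open>R\<close> together have weight at most
  \<open>2 \<sigma> (1 - R)\<close> (\<open>sum_phi_tail_le\<close>), while the total weight in each coordinate is at least
  \<open>\<sigma> 1 - 1/2\<close> (\<open>sum_phi_lower_bound\<close>), which is positive by concavity. With \<open>R = n \<delta>\<close> and the
  decay of \<open>\<sigma>\<close> at minus infinity the error is \<open>O(n powr (- \<nu> (1 - \<theta>)))\<close>, uniformly in \<open>x\<close> and
  in the image.

  The remaining points lie in strips of width \<open>\<delta>\<close> on either side of the pixel edges. There an average of
  values in \<open>[0, 255]\<close> differs from \<open>f x\<close> by at most 255, and the strips have total area at most
  \<open>4 N M \<delta>\<close> (\<open>measure_edge_region_le\<close>).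

  Integrating the \<open>p\<close>-th power over both parts and using subadditivity of \<open>t powr (1 / p)\<close>
  (\<open>Lp_norm_le_off_small_set\<close>) yields the two terms of the estimate.\<close>

section \<open>Sigmoidal functions\<close>

lemma sigmoidal_mono_bounds:
  assumes "mono \<sigma>" and "sigmoidal \<sigma>"
  shows "0 \<le> \<sigma> x" and "\<sigma> x \<le> 1"
proof -
  have bot: "(\<sigma> \<longlongrightarrow> 0) at_bot" and top: "(\<sigma> \<longlongrightarrow> 1) at_top"
    using assms(2) by (auto simp: sigmoidal_def)
  have "eventually (\<lambda>y. \<sigma> y \<le> \<sigma> x) at_bot"
    using eventually_le_at_bot[of x] by eventually_elim (use assms(1) in \<open>auto dest: monoD\<close>)
  with bot show "0 \<le> \<sigma> x"
    by (intro tendsto_upperbound[OF bot]) auto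
  have "eventually (\<lambda>y. \<sigma> x \<le> \<sigma> y) at_top"
    using eventually_ge_at_top[of x] by eventually_elim (use assms(1) in \<open>auto dest: monoD\<close>)
  with top show "\<sigma> x \<le> 1"
    by (intro tendsto_lowerbound[OF top]) auto
qed

lemma sigmoidal_reflect:
  assumes "odd_function (\<lambda>x. \<sigma> x - 1 / 2)"
  shows "\<sigma> (- x) = 1 - \<sigma> x"
proof -
  have "\<sigma> (- x) - 1 / 2 = - (\<sigma> x - 1 / 2)"
    using assms by (simp add: odd_function_def)
  then show ?thesis by simp
qed

text \<open>A concave function that does not rise on \<open>[0, 1]\<close> never rises afterwards, which would
  keep \<open>\<sigma>\<close> at or below \<open>1/2\<close> and contradict the limit 1.\<close>

lemma concave_sigmoidal_one_gt_half:
  assumes "sigmoidal \<sigma>" and "odd_function (\<lambda>x. \<sigma> x - 1 / 2)" and "concave_on {0..} \<sigma>"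
  shows "1 / 2 < \<sigma> 1"
proof -
  have half: "\<sigma> 0 = 1 / 2"
    using sigmoidal_reflect[OF assms(2), of 0] by simp
  have "(\<sigma> \<longlongrightarrow> 1) at_top"
    using assms(1) by (simp add: sigmoidal_def)
  then have "eventually (\<lambda>t. 1 / 2 < \<sigma> t) at_top"
    by (rule order_tendstoD) simp
  then have "eventually (\<lambda>t. 1 / 2 < \<sigma> t \<and> 1 \<le> t) at_top"
    using eventually_ge_at_top[of 1] by eventually_elim simp
  then obtain t where t: "1 / 2 < \<sigma> t" "1 \<le> t"
    by (auto simp: eventually_at_top_linorder)
  have "(1 - 1 / t) * \<sigma> 0 + (1 / t) * \<sigma> t \<le> \<sigma> ((1 - 1 / t) *\<^sub>R 0 + (1 / t) *\<^sub>R t)"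
    using t by (intro concave_onD[OF assms(3)]) auto
  moreover have "(1 / t) * (1 / 2) < (1 / t) * \<sigma> t"
    using t by (intro mult_strict_left_mono) auto
  moreover have "(1 - 1 / t) * \<sigma> 0 = 1 / 2 - (1 / t) * (1 / 2)"
    using half by (simp add: algebra_simps)
  ultimately show ?thesis
    using t by simp
qed

text \<open>The decay is known only far out on the left. Since \<open>\<sigma> \<le> 1\<close>, a larger constant
  absorbs the bounded range of \<open>R\<close>, which makes the estimate uniform in \<open>R \<ge> 1\<close> and later in
  \<open>n \<ge> 1\<close>.\<close>

lemma sigmoidal_decay:
  assumes "mono \<sigma>" and "sigmoidal \<sigma>" and "\<sigma> \<in> O[at_bot](\<lambda>x. \<bar>x\<bar> powr (- \<beta>))"
    and "0 < \<nu>" and "\<nu> \<le> \<beta>"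
  shows "\<exists>C>0. \<forall>R\<ge>1. \<sigma> (1 - R) \<le> C * R powr (- \<nu>)"
proof -
  obtain c where c: "0 < c"
      "eventually (\<lambda>x. norm (\<sigma> x) \<le> c * norm (\<bar>x\<bar> powr (- \<beta>))) at_bot"
    using assms(3) by (auto elim!: landau_o.bigE)
  then obtain X where X: "\<And>x. x \<le> X \<Longrightarrow> norm (\<sigma> x) \<le> c * norm (\<bar>x\<bar> powr (- \<beta>))"
    by (auto simp: eventually_at_bot_linorder)
  (* For R \<ge> R0 the point 1 - R is in the range of the asymptotic bound, and
     R - 1 \<ge> R / 2. *)
  define R0 where "R0 = max 2 (1 - X)"
  have R0: "2 \<le> R0" "1 - X \<le> R0" by (auto simp: R0_def)
  show ?thesis
  proof (intro exI conjI allI impI)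
    show "0 < c * 2 powr \<beta> + R0 powr \<nu>"
      using c R0 by (intro add_pos_pos) auto
    fix R :: real assume R: "1 \<le> R"
    show "\<sigma> (1 - R) \<le> (c * 2 powr \<beta> + R0 powr \<nu>) * R powr (- \<nu>)"
    proof (cases "R0 \<le> R")
      case True
      have "\<sigma> (1 - R) \<le> c * (R - 1) powr (- \<beta>)"
        using X[of "1 - R"] True R0 R by simp
      also have "\<dots> \<le> c * (R / 2) powr (- \<beta>)"
        using True R0 c assms(4,5) by (intro mult_left_mono powr_mono2') auto
      also have "\<dots> = c * 2 powr \<beta> * R powr (- \<beta>)"
        using R by (simp add: powr_divide powr_minus field_simps)
      also have "\<dots> \<le> c * 2 powr \<beta> * R powr (- \<nu>)"
        using R assms(5) c by (intro mult_left_mono powr_mono) auto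
      also have "\<dots> \<le> (c * 2 powr \<beta> + R0 powr \<nu>) * R powr (- \<nu>)"
        by (intro mult_right_mono) auto
      finally show ?thesis .
    next
      case False
      have "\<sigma> (1 - R) \<le> R powr \<nu> * R powr (- \<nu>)"
        using sigmoidal_mono_bounds(2)[OF assms(1,2), of "1 - R"] R
        by (simp add: powr_minus field_simps)
      also have "\<dots> \<le> R0 powr \<nu> * R powr (- \<nu>)"
        using False R assms(4) by (intro mult_right_mono powr_mono2) auto
      also have "\<dots> \<le> (c * 2 powr \<beta> + R0 powr \<nu>) * R powr (- \<nu>)"
        using c by (intro mult_right_mono) auto
      finally show ?thesis .
    qed
  qed
qed

section \<open>Sums of translates of the kernel\<close>

lemma phi_nonneg:
  assumes "mono \<sigma>"
  shows "0 \<le> phi \<sigma> x"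
  using monoD[OF assms, of "x - 1" "x + 1"] by (simp add: phi_def)

text \<open>Each term is a difference of values of \<open>\<sigma>\<close> at distance 2, so the sum over consecutive
  integers telescopes to two boundary values at either end. Both the lower bound on the total mass
  and the bound on the tails come from this identity.\<close>

lemma sum_phi_telescope:
  fixes a b :: int and y :: real
  assumes "a \<le> b"
  shows "(\<Sum>k=a..b. phi \<sigma> (y - of_int k)) =
    (\<sigma> (y - a + 1) + \<sigma> (y - a) - \<sigma> (y - b) - \<sigma> (y - b - 1)) / 2"
  using assms
proof (induction b rule: int_ge_induct)
  case base
  then show ?case by (simp add: phi_def)
next
  case (step b)
  have "{a..b + 1} = insert (b + 1) {a..b}" using step.hyps by auto
  then show ?case
    using step.IH by (simp add: phi_def algebra_simps)
qed

text \<open>For \<open>y\<close> in \<open>[0, m]\<close> the two values of \<open>\<sigma>\<close> at the left end of the telescoped sum have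
  arguments at least 1 and 0, the two at the right end at most 0 and -1; \<open>\<sigma> 0 = 1/2\<close> and
  symmetry do the rest.\<close>

lemma sum_phi_lower_bound:
  assumes "mono \<sigma>" and "odd_function (\<lambda>x. \<sigma> x - 1 / 2)" and "0 \<le> y" and "y \<le> of_int m"
  shows "\<sigma> 1 - 1 / 2 \<le> (\<Sum>k=0..m. phi \<sigma> (y - of_int k))"
proof -
  have half: "\<sigma> 0 = 1 / 2"
    using sigmoidal_reflect[OF assms(2), of 0] by simp
  have "\<sigma> 1 \<le> \<sigma> (y + 1)" "\<sigma> 0 \<le> \<sigma> y" "\<sigma> (y - m) \<le> \<sigma> 0" "\<sigma> (y - m - 1) \<le> \<sigma> (- 1)"
    using assms(3,4) by (auto intro!: monoD[OF assms(1)])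
  moreover have "0 \<le> m" using assms(3,4) by linarith
  ultimately show ?thesis
    using half sigmoidal_reflect[OF assms(2), of 1] by (simp add: sum_phi_telescope)
qed

text \<open>Each of the two tails is a block of consecutive integers; after telescoping, the left one is
  at most \<open>1 - \<sigma> (R - 1)\<close> and the right one at most \<open>\<sigma> (1 - R)\<close>, and these agree by symmetry.\<close>

lemma sum_phi_tail_le:
  assumes "mono \<sigma>" and "sigmoidal \<sigma>" and "odd_function (\<lambda>x. \<sigma> x - 1 / 2)"
  shows "(\<Sum>k\<in>{k\<in>{0..m}. R \<le> \<bar>y - of_int k\<bar>}. phi \<sigma> (y - of_int k)) \<le> 2 * \<sigma> (1 - R)"
proof -
  define b where "b = min m \<lfloor>y - R\<rfloor>"
  define a where "a = max 0 \<lceil>y + R\<rceil>"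
  note bounds = sigmoidal_mono_bounds[OF assms(1,2)]
  have left: "(\<Sum>k=0..b. phi \<sigma> (y - of_int k)) \<le> \<sigma> (1 - R)"
  proof (cases "0 \<le> b")
    case True
    have "of_int b \<le> y - R" unfolding b_def by linarith
    then have "\<sigma> (R - 1) \<le> \<sigma> (y - b)" "\<sigma> (R - 1) \<le> \<sigma> (y - b - 1)"
      by (auto intro!: monoD[OF assms(1)])
    then show ?thesis
      using True bounds(2)[of "y + 1"] bounds(2)[of y] sigmoidal_reflect[OF assms(3), of "R - 1"]
      by (simp add: sum_phi_telescope)
  qed (simp add: bounds)
  have right: "(\<Sum>k=a..m. phi \<sigma> (y - of_int k)) \<le> \<sigma> (1 - R)"
  proof (cases "a \<le> m")
    case True
    have "y + R \<le> of_int a" unfolding a_def by linarith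
    then have "\<sigma> (y - a + 1) \<le> \<sigma> (1 - R)" "\<sigma> (y - a) \<le> \<sigma> (1 - R)"
      by (auto intro!: monoD[OF assms(1)])
    then show ?thesis
      using True bounds(1)[of "y - m"] bounds(1)[of "y - m - 1"]
      by (simp add: sum_phi_telescope)
  qed (simp add: bounds)
  have "{k\<in>{0..m}. R \<le> \<bar>y - of_int k\<bar>} \<subseteq> {0..b} \<union> {a..m}"
    unfolding a_def b_def by (auto simp: le_floor_iff ceiling_le_iff)
  then have "(\<Sum>k\<in>{k\<in>{0..m}. R \<le> \<bar>y - of_int k\<bar>}. phi \<sigma> (y - of_int k))
      \<le> (\<Sum>k\<in>{0..b} \<union> {a..m}. phi \<sigma> (y - of_int k))"
    by (intro sum_mono2) (auto intro: phi_nonneg[OF assms(1)])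
  also have "\<dots> \<le> (\<Sum>k=0..b. phi \<sigma> (y - of_int k)) + (\<Sum>k=a..m. phi \<sigma> (y - of_int k))"
    by (simp add: sum_Un sum_nonneg phi_nonneg[OF assms(1)])
  finally show ?thesis using left right by linarith
qed

section \<open>The operator as a weighted average\<close>

text \<open>A contributing pair has its first entry in \<open>A'\<close> or its second in \<open>B'\<close>. Summing out the
  other entry cancels one factor of the denominator, so each case costs at most the relative
  weight \<open>T / D\<close> of a one-dimensional tail.\<close>

lemma sum_times_product:
  fixes u :: "'a \<Rightarrow> real" and v :: "'b \<Rightarrow> real"
  shows "(\<Sum>(a, b)\<in>A \<times> B. u a * v b) = sum u A * sum v B"
  by (simp add: sum_product sum.cartesian_product)

lemma product_average_le:
  fixes u v :: "int \<Rightarrow> real" and h :: "int \<Rightarrow> int \<Rightarrow> real"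
  assumes fin: "finite A" "finite B" and sub: "A' \<subseteq> A" "B' \<subseteq> B"
    and pos: "\<And>a. 0 \<le> u a" "\<And>b. 0 \<le> v b"
    and D: "0 < D" "D \<le> sum u A" "D \<le> sum v B"
    and T: "sum u A' \<le> T" "sum v B' \<le> T"
    and h: "\<And>a b. a \<in> A \<Longrightarrow> b \<in> B \<Longrightarrow> \<bar>h a b\<bar> \<le> c"
    and h0: "\<And>a b. a \<in> A - A' \<Longrightarrow> b \<in> B - B' \<Longrightarrow> h a b = 0"
    and c: "0 \<le> c"
  shows "\<bar>(\<Sum>(a, b)\<in>A \<times> B. h a b * (u a * v b)) / (sum u A * sum v B)\<bar> \<le> c * (2 * T / D)"
proof -
  have T0: "0 \<le> T" using T(1) sum_nonneg[of A' u] pos by (meson order_trans)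
  have "\<bar>\<Sum>(a, b)\<in>A \<times> B. h a b * (u a * v b)\<bar> \<le> (\<Sum>(a, b)\<in>A \<times> B. \<bar>h a b\<bar> * (u a * v b))"
    using pos by (intro order_trans[OF sum_abs]) (auto intro!: sum_mono simp: abs_mult)
  also have "\<dots> \<le> (\<Sum>(a, b)\<in>A \<times> B. c * (u a * indicator A' a * v b + u a * (v b * indicator B' b)))"
  proof (intro sum_mono, clarify)
    fix a b assume ab: "a \<in> A" "b \<in> B"
    have uv: "0 \<le> u a * v b" "0 \<le> c * (u a * v b)" using pos c by auto
    have "\<bar>h a b\<bar> * (u a * v b) \<le> c * (u a * v b)"
      using h[OF ab] uv by (intro mult_right_mono) auto
    then show "\<bar>h a b\<bar> * (u a * v b) \<le>
        c * (u a * indicator A' a * v b + u a * (v b * indicator B' b))"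
      using h0[of a b] ab uv by (auto simp: indicator_def algebra_simps)
  qed
  also have "\<dots> = c * ((\<Sum>(a, b)\<in>A \<times> B. u a * indicator A' a * v b)
      + (\<Sum>(a, b)\<in>A \<times> B. u a * (v b * indicator B' b)))"
    by (simp add: case_prod_beta sum.distrib sum_distrib_left distrib_left)
  also have "\<dots> = c * ((\<Sum>a\<in>A. u a * indicator A' a) * sum v B
      + sum u A * (\<Sum>b\<in>B. v b * indicator B' b))"
    by (simp only: sum_times_product)
  also have "\<dots> = c * (sum u A' * sum v B + sum u A * sum v B')"
  proof -
    have "(\<Sum>a\<in>A. u a * indicator A' a) = sum u A'" "(\<Sum>b\<in>B. v b * indicator B' b) = sum v B'"
      by (intro sum.mono_neutral_cong_right; use fin sub in auto)+
    then show ?thesis by simp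
  qed
  also have "\<dots> \<le> c * (T * sum v B + sum u A * T)"
    using T D c by (intro mult_left_mono add_mono mult_right_mono) auto
  also have "\<dots> \<le> c * ((2 * T / D) * (sum u A * sum v B))"
  proof (intro mult_left_mono c)
    have "T * sum v B * D \<le> T * sum v B * sum u A" "sum u A * T * D \<le> sum u A * T * sum v B"
      using T0 D by (auto intro!: mult_left_mono)
    then show "T * sum v B + sum u A * T \<le> (2 * T / D) * (sum u A * sum v B)"
      using D(1) by (simp add: field_simps)
  qed
  finally have "\<bar>\<Sum>(a, b)\<in>A \<times> B. h a b * (u a * v b)\<bar>
      \<le> c * (2 * T / D) * (sum u A * sum v B)"
    by (simp add: mult.assoc)
  moreover have "0 < sum u A * sum v B" using D by auto
  ultimately show ?thesis by (simp add: pos_divide_le_eq)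
qed

lemma product_average_abs_le:
  fixes u v :: "int \<Rightarrow> real" and h :: "int \<Rightarrow> int \<Rightarrow> real"
  assumes pos: "\<And>a. 0 \<le> u a" "\<And>b. 0 \<le> v b" and S: "0 < sum u A" "0 < sum v B"
    and h: "\<And>a b. a \<in> A \<Longrightarrow> b \<in> B \<Longrightarrow> \<bar>h a b\<bar> \<le> c"
  shows "\<bar>(\<Sum>(a, b)\<in>A \<times> B. h a b * (u a * v b)) / (sum u A * sum v B)\<bar> \<le> c"
proof -
  have "\<bar>\<Sum>(a, b)\<in>A \<times> B. h a b * (u a * v b)\<bar> \<le> (\<Sum>(a, b)\<in>A \<times> B. \<bar>h a b\<bar> * (u a * v b))"
    using pos by (intro order_trans[OF sum_abs]) (auto intro!: sum_mono simp: abs_mult)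
  also have "\<dots> \<le> (\<Sum>(a, b)\<in>A \<times> B. c * (u a * v b))"
    using pos h by (intro sum_mono) (auto intro!: mult_right_mono)
  also have "\<dots> = c * (sum u A * sum v B)"
    unfolding sum_times_product[symmetric] by (simp add: case_prod_beta sum_distrib_left)
  finally show ?thesis using S by (simp add: pos_divide_le_eq)
qed

text \<open>The weights add up to the denominator, so a constant can be subtracted inside the average.
  The tensor structure of \<open>Psi\<close> factors the denominator into one-dimensional sums.\<close>

lemma nn_operator_minus_eq:
  fixes \<sigma> :: "real \<Rightarrow> real" and x :: "real \<times> real" and n N M :: nat
  defines "A \<equiv> {0..int (n * N)}" and "B \<equiv> {0..int (n * M)}"
  defines "u \<equiv> \<lambda>k. phi \<sigma> (real n * fst x - of_int k)"
    and "v \<equiv> \<lambda>k. phi \<sigma> (real n * snd x - of_int k)"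
  assumes "0 < sum u A" and "0 < sum v B"
  shows "nn_operator \<sigma> N M n f x - c =
    (\<Sum>(a, b)\<in>A \<times> B. (f (of_int a / real n, of_int b / real n) - c) * (u a * v b)) /
      (sum u A * sum v B)"
proof -
  have grid: "nn_grid N M n = A \<times> B"
    by (auto simp: nn_grid_def A_def B_def)
  have mass: "(\<Sum>(a, b)\<in>A \<times> B. u a * v b) = sum u A * sum v B"
    by (rule sum_times_product)
  have "(\<Sum>(a, b)\<in>A \<times> B. (f (of_int a / real n, of_int b / real n) - c) * (u a * v b)) =
      (\<Sum>(a, b)\<in>A \<times> B. f (of_int a / real n, of_int b / real n) * (u a * v b))
      - c * (\<Sum>(a, b)\<in>A \<times> B. u a * v b)"
    by (simp add: sum_subtractf sum_distrib_left left_diff_distrib case_prod_beta)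
  then have diff: "(\<Sum>(a, b)\<in>A \<times> B. (f (of_int a / real n, of_int b / real n) - c) * (u a * v b)) =
      (\<Sum>(a, b)\<in>A \<times> B. f (of_int a / real n, of_int b / real n) * (u a * v b))
      - c * (sum u A * sum v B)"
    unfolding mass .
  have op: "nn_operator \<sigma> N M n f x =
      (\<Sum>(a, b)\<in>A \<times> B. f (of_int a / real n, of_int b / real n) * (u a * v b)) /
        (sum u A * sum v B)"
    unfolding nn_operator_def grid Psi_def mass[symmetric] by (simp add: u_def v_def)
  show ?thesis
    unfolding op diff using assms(5,6) by (simp add: diff_divide_distrib)
qed

section \<open>Digital images\<close>

lemma pixel_side_unique:
  assumes "i \<in> {1..N}" and "i' \<in> {1..N}" and "x \<in> pixel_side N i" and "x \<in> pixel_side N i'"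
  shows "i = i'"
proof (rule ccontr)
  assume "i \<noteq> i'"
  then consider "real i + 1 \<le> real i'" | "real i' + 1 \<le> real i" by linarith
  then show False
    using assms by cases (auto simp: pixel_side_def split: if_splits)
qed

lemma pixel_side_exists:
  assumes "x \<in> {0..real N}" and "0 < N"
  shows "\<exists>i\<in>{1..N}. x \<in> pixel_side N i"
proof (cases "x = real N")
  case True
  then show ?thesis using assms(2) by (intro bexI[of _ N]) (auto simp: pixel_side_def)
next
  case False
  then have x: "0 \<le> x" "x < real N" using assms(1) by auto
  define i where "i = nat \<lfloor>x\<rfloor> + 1"
  have "real i - 1 \<le> x" "x < real i" using x unfolding i_def by linarith+
  moreover have "i \<in> {1..N}" using x unfolding i_def by (simp add: floor_less_iff nat_less_iff Suc_leI)
  ultimately show ?thesis by (intro bexI[of _ i]) (auto simp: pixel_side_def)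
qed

lemma digital_image_sum_eq:
  fixes F :: "nat \<Rightarrow> nat \<Rightarrow> nat"
  assumes ij: "i \<in> {1..N}" "j \<in> {1..M}" and x: "x \<in> pixel N M i j"
  shows "(\<Sum>i=1..N. \<Sum>j=1..M. real (F i j) * indicator (pixel N M i j) x) = real (F i j)"
proof -
  have "real (F i' j') * indicator (pixel N M i' j') x =
      (if i' = i then if j' = j then real (F i j) else 0 else 0)"
    if "i' \<in> {1..N}" "j' \<in> {1..M}" for i' j'
    using that ij x pixel_side_unique[of i N i' "fst x"] pixel_side_unique[of j M j' "snd x"]
    by (auto simp: pixel_def indicator_def)
  then have "(\<Sum>i'=1..N. \<Sum>j'=1..M. real (F i' j') * indicator (pixel N M i' j') x) =
      (\<Sum>i'=1..N. \<Sum>j'=1..M. if i' = i then if j' = j then real (F i j) else 0 else 0)"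
    by (intro sum.cong refl) auto
  also have "\<dots> = (\<Sum>i'=1..N. if i' = i then \<Sum>j'=1..M. if j' = j then real (F i j) else 0 else 0)"
    by (intro sum.cong) auto
  finally show ?thesis using ij by simp
qed

lemma digital_image_bounds:
  assumes "digital_image N M f" and "0 < N" and "0 < M" and "x \<in> image_domain N M"
  shows "0 \<le> f x" and "f x \<le> 255"
proof -
  obtain F :: "nat \<Rightarrow> nat \<Rightarrow> nat"
    where F: "\<forall>i\<in>{1..N}. \<forall>j\<in>{1..M}. F i j \<in> {0..255}"
      "\<forall>x\<in>image_domain N M. f x = (\<Sum>i=1..N. \<Sum>j=1..M. real (F i j) * indicator (pixel N M i j) x)"
    using assms(1) unfolding digital_image_def by blast
  obtain i j where ij: "i \<in> {1..N}" "j \<in> {1..M}" "x \<in> pixel N M i j"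
    using pixel_side_exists[of "fst x" N] pixel_side_exists[of "snd x" M] assms(2-4)
    by (fastforce simp: image_domain_def pixel_def)
  have "f x = real (F i j)"
    using F(2) assms(4) digital_image_sum_eq[OF ij, of F] by simp
  then show "0 \<le> f x" and "f x \<le> 255" using F(1) ij by auto
qed

lemma digital_image_constant_on_pixel:
  assumes "digital_image N M f" and ij: "i \<in> {1..N}" "j \<in> {1..M}"
    and "x \<in> pixel N M i j" and "x' \<in> pixel N M i j"
  shows "f x = f x'"
proof -
  obtain F :: "nat \<Rightarrow> nat \<Rightarrow> nat"
    where F: "\<forall>x\<in>image_domain N M.
      f x = (\<Sum>i=1..N. \<Sum>j=1..M. real (F i j) * indicator (pixel N M i j) x)"
    using assms(1) unfolding digital_image_def by blast
  have side: "pixel_side K k \<subseteq> {0..real K}" if "k \<in> {1..K}" for K k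
    using that by (auto simp: pixel_side_def split: if_splits)
  have sub: "pixel N M i j \<subseteq> image_domain N M"
    using side[OF ij(1)] side[OF ij(2)] by (auto simp: pixel_def image_domain_def)
  have "f z = real (F i j)" if "z \<in> pixel N M i j" for z
    using that sub F digital_image_sum_eq[OF ij that, of F] by auto
  then show ?thesis using assms(4,5) by simp
qed

lemma digital_image_measurable:
  assumes "digital_image N M f"
  shows "f \<in> borel_measurable (lebesgue_on (image_domain N M))"
proof -
  obtain F :: "nat \<Rightarrow> nat \<Rightarrow> nat"
    where F: "\<forall>x\<in>image_domain N M.
      f x = (\<Sum>i=1..N. \<Sum>j=1..M. real (F i j) * indicator (pixel N M i j) x)"
    using assms unfolding digital_image_def by blast
  have side [measurable]: "pixel_side K k \<in> sets borel" for K k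
    by (simp add: pixel_side_def)
  have pixel: "pixel N M i j \<in> sets borel" for i j
    unfolding pixel_def borel_prod[symmetric] by measurable
  have "(\<lambda>x. \<Sum>i=1..N. \<Sum>j=1..M. real (F i j) * indicator (pixel N M i j) x) \<in> borel_measurable borel"
    using pixel by (intro borel_measurable_sum borel_measurable_times borel_measurable_indicator) auto
  then have "(\<lambda>x. \<Sum>i=1..N. \<Sum>j=1..M. real (F i j) * indicator (pixel N M i j) x)
      \<in> borel_measurable (lebesgue_on (image_domain N M))"
    by (intro measurable_restrict_space1 measurable_completion) simp
  then show ?thesis
    using F by (subst measurable_cong[of _ _ "\<lambda>x. \<Sum>i=1..N. \<Sum>j=1..M. real (F i j) * indicator (pixel N M i j) x"]) auto
qed

lemma nn_operator_measurable:
  assumes "mono \<sigma>"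
  shows "nn_operator \<sigma> N M n f \<in> borel_measurable (lebesgue_on S)"
proof -
  have [measurable]: "\<sigma> \<in> borel_measurable borel"
    using assms by (rule borel_measurable_mono)
  have "nn_operator \<sigma> N M n f \<in> borel_measurable (borel \<Otimes>\<^sub>M borel)"
    unfolding nn_operator_def Psi_def phi_def case_prod_beta by measurable
  then show ?thesis
    by (intro measurable_restrict_space1 measurable_completion) (simp add: borel_prod)
qed

section \<open>Strips along the pixel edges\<close>

definition edge_strips :: "nat \<Rightarrow> real \<Rightarrow> real set" where
  "edge_strips N \<delta> = (\<Union>i\<in>{1..N}. {real i - 1..real i - 1 + \<delta>} \<union> {real i - \<delta>..real i})"

lemma off_edge_strips:
  assumes "x \<in> {0..real N}" and "0 < N" and "x \<notin> edge_strips N \<delta>"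
  shows "\<exists>i\<in>{1..N}. real i - 1 + \<delta> < x \<and> x < real i - \<delta>"
proof -
  obtain i where i: "i \<in> {1..N}" "x \<in> pixel_side N i"
    using pixel_side_exists[OF assms(1,2)] by blast
  then have "x \<in> {real i - 1..real i}" by (auto simp: pixel_side_def split: if_splits)
  then show ?thesis using i(1) assms(3) by (intro bexI[OF _ i(1)]) (force simp: edge_strips_def)
qed

definition edge_region :: "nat \<Rightarrow> nat \<Rightarrow> real \<Rightarrow> (real \<times> real) set" where
  "edge_region N M \<delta> = edge_strips N \<delta> \<times> {0..real M} \<union> {0..real N} \<times> edge_strips M \<delta>"

lemma box_lmeasurable:
  fixes a b c d :: real
  shows "{a..b} \<times> {c..d} \<in> lmeasurable"
  using lmeasurable_cbox[of "(a, c)" "(b, d)"] by (simp only: cbox_Pair_eq box_real)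

lemma measure_box:
  fixes a b c d :: real
  assumes "a \<le> b" and "c \<le> d"
  shows "measure lebesgue ({a..b} \<times> {c..d}) = (b - a) * (d - c)"
proof -
  have "{a..b} \<times> {c..d} \<in> sets lborel"
    by (simp add: borel_closed closed_Times)
  then show ?thesis
    using content_Pair[of a c b d] assms by (simp add: cbox_Pair_eq)
qed

lemma edge_strips_times:
  fixes \<delta> K :: real
  assumes "0 \<le> \<delta>" and "0 \<le> K"
  shows "edge_strips N \<delta> \<times> {0..K} \<in> lmeasurable"
    and "measure lebesgue (edge_strips N \<delta> \<times> {0..K}) \<le> 2 * \<delta> * N * K"
    and "{0..K} \<times> edge_strips N \<delta> \<in> lmeasurable"
    and "measure lebesgue ({0..K} \<times> edge_strips N \<delta>) \<le> 2 * \<delta> * N * K"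
proof -
  have eq: "edge_strips N \<delta> \<times> {0..K} =
      (\<Union>i\<in>{1..N}. {real i - 1..real i - 1 + \<delta>} \<times> {0..K} \<union> {real i - \<delta>..real i} \<times> {0..K})"
    and eq': "{0..K} \<times> edge_strips N \<delta> =
      (\<Union>i\<in>{1..N}. {0..K} \<times> {real i - 1..real i - 1 + \<delta>} \<union> {0..K} \<times> {real i - \<delta>..real i})"
    by (auto simp: edge_strips_def)
  show "edge_strips N \<delta> \<times> {0..K} \<in> lmeasurable" "{0..K} \<times> edge_strips N \<delta> \<in> lmeasurable"
    unfolding eq eq' by (intro fmeasurable.finite_UN fmeasurable.Un box_lmeasurable; simp)+
  have "measure lebesgue (edge_strips N \<delta> \<times> {0..K}) \<le> (\<Sum>i\<in>{1..N}. 2 * \<delta> * K)"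
    unfolding eq
    by (intro order_trans[OF measure_UNION_le] sum_mono order_trans[OF measure_Un_le])
      (use assms in \<open>auto simp: measure_box algebra_simps intro!: fmeasurableD box_lmeasurable sets.Un\<close>)
  then show "measure lebesgue (edge_strips N \<delta> \<times> {0..K}) \<le> 2 * \<delta> * N * K"
    by (simp add: algebra_simps)
  have "measure lebesgue ({0..K} \<times> edge_strips N \<delta>) \<le> (\<Sum>i\<in>{1..N}. 2 * \<delta> * K)"
    unfolding eq'
    by (intro order_trans[OF measure_UNION_le] sum_mono order_trans[OF measure_Un_le])
      (use assms in \<open>auto simp: measure_box algebra_simps intro!: fmeasurableD box_lmeasurable sets.Un\<close>)
  then show "measure lebesgue ({0..K} \<times> edge_strips N \<delta>) \<le> 2 * \<delta> * N * K"
    by (simp add: algebra_simps)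
qed

lemma edge_region_lmeasurable:
  assumes "0 \<le> \<delta>"
  shows "edge_region N M \<delta> \<in> lmeasurable"
  unfolding edge_region_def using assms by (intro fmeasurable.Un edge_strips_times) auto

lemma measure_edge_region_le:
  assumes "0 \<le> \<delta>"
  shows "measure lebesgue (edge_region N M \<delta>) \<le> 4 * \<delta> * N * M"
proof -
  have "measure lebesgue (edge_region N M \<delta>) \<le>
      measure lebesgue (edge_strips N \<delta> \<times> {0..real M}) + measure lebesgue ({0..real N} \<times> edge_strips M \<delta>)"
    unfolding edge_region_def using assms
    by (intro measure_Un_le fmeasurableD edge_strips_times) auto
  then show ?thesis
    using edge_strips_times(2)[OF assms, of "real M" N] edge_strips_times(4)[OF assms, of "real N" M]
    by (simp add: algebra_simps)
qed

section \<open>Pointwise error\<close>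

context
  fixes \<sigma> :: "real \<Rightarrow> real" and N M n :: nat and f :: "real \<times> real \<Rightarrow> real" and x :: "real \<times> real"
  assumes sigma: "mono \<sigma>" "sigmoidal \<sigma>" "odd_function (\<lambda>x. \<sigma> x - 1 / 2)" "concave_on {0..} \<sigma>"
    and image: "digital_image N M f" and pos: "0 < N" "0 < M" "0 < n"
    and x: "x \<in> image_domain N M"
begin

lemma phi_mass:
  shows "\<sigma> 1 - 1 / 2 \<le> (\<Sum>k=0..int (n * N). phi \<sigma> (real n * fst x - of_int k))"
    and "\<sigma> 1 - 1 / 2 \<le> (\<Sum>k=0..int (n * M). phi \<sigma> (real n * snd x - of_int k))"
  using x pos by (auto intro!: sum_phi_lower_bound sigma simp: image_domain_def mult_left_mono)

lemma phi_mass_pos: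
  shows "0 < (\<Sum>k=0..int (n * N). phi \<sigma> (real n * fst x - of_int k))"
    and "0 < (\<Sum>k=0..int (n * M). phi \<sigma> (real n * snd x - of_int k))"
  using phi_mass concave_sigmoidal_one_gt_half[OF sigma(2-4)] by linarith+

lemma grid_point_difference_le:
  assumes "a \<in> {0..int (n * N)}" and "b \<in> {0..int (n * M)}"
  shows "\<bar>f (of_int a / real n, of_int b / real n) - f x\<bar> \<le> 255"
proof -
  have "real_of_int a \<le> of_int (int (n * N))" "real_of_int b \<le> of_int (int (n * M))"
    using assms by (simp_all only: of_int_le_iff atLeastAtMost_iff)
  then have "(of_int a / real n, of_int b / real n) \<in> image_domain N M"
    using assms pos by (auto simp: image_domain_def field_simps)
  then show ?thesis
    using digital_image_bounds[OF image pos(1,2)] x by (smt (verit))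
qed

text \<open>Both the average and \<open>f x\<close> lie in \<open>[0, 255]\<close>, which is all that is known near the edges.\<close>

lemma nn_operator_error_le:
  shows "\<bar>nn_operator \<sigma> N M n f x - f x\<bar> \<le> 255"
  unfolding nn_operator_minus_eq[OF phi_mass_pos]
  by (rule product_average_abs_le[where u = "\<lambda>k. phi \<sigma> (real n * fst x - of_int k)"
        and v = "\<lambda>k. phi \<sigma> (real n * snd x - of_int k)"
        and h = "\<lambda>a b. f (of_int a / real n, of_int b / real n) - f x"])
    (assumption | rule phi_mass_pos phi_nonneg sigma grid_point_difference_le)+

text \<open>A node within distance \<open>\<delta>\<close> of \<open>x\<close> in both coordinates lies in the pixel of \<open>x\<close> and
  contributes no error, so only the tails of the two kernel sums remain.\<close>

lemma nn_operator_error_off_edges: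
  assumes "x \<notin> edge_region N M \<delta>"
  shows "\<bar>nn_operator \<sigma> N M n f x - f x\<bar> \<le>
    255 * (2 * (2 * \<sigma> (1 - real n * \<delta>)) / (\<sigma> 1 - 1 / 2))"
proof -
  obtain i where i: "i \<in> {1..N}" "real i - 1 + \<delta> < fst x" "fst x < real i - \<delta>"
    using off_edge_strips[of "fst x" N \<delta>] assms x pos by (cases x) (auto simp: edge_region_def image_domain_def)
  obtain j where j: "j \<in> {1..M}" "real j - 1 + \<delta> < snd x" "snd x < real j - \<delta>"
    using off_edge_strips[of "snd x" M \<delta>] assms x pos by (cases x) (auto simp: edge_region_def image_domain_def)
  have near: "\<bar>t - of_int a / real n\<bar> < \<delta>" if "\<not> real n * \<delta> \<le> \<bar>real n * t - of_int a\<bar>" for t and a :: int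
  proof -
    have "t - of_int a / real n = (real n * t - of_int a) / real n"
      using pos by (simp add: field_simps)
    then have "\<bar>t - of_int a / real n\<bar> = \<bar>real n * t - of_int a\<bar> / real n"
      by (simp only: abs_divide abs_of_nat)
    then show ?thesis using that pos by (simp add: divide_less_eq mult.commute)
  qed
  let ?A = "{k \<in> {0..int (n * N)}. real n * \<delta> \<le> \<bar>real n * fst x - of_int k\<bar>}"
  let ?B = "{k \<in> {0..int (n * M)}. real n * \<delta> \<le> \<bar>real n * snd x - of_int k\<bar>}"
  have same: "f (of_int a / real n, of_int b / real n) - f x = 0"
    if "a \<in> {0..int (n * N)} - ?A" "b \<in> {0..int (n * M)} - ?B" for a b
  proof -
    have "\<bar>fst x - of_int a / real n\<bar> < \<delta>" "\<bar>snd x - of_int b / real n\<bar> < \<delta>"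
      using that by (auto intro!: near)
    then have "(of_int a / real n, of_int b / real n) \<in> pixel N M i j" "x \<in> pixel N M i j"
      using i j by (cases x; auto simp: pixel_def pixel_side_def)+
    from digital_image_constant_on_pixel[OF image i(1) j(1) this] show ?thesis
      by simp
  qed
  show ?thesis
    unfolding nn_operator_minus_eq[OF phi_mass_pos]
  proof (rule product_average_le[where u = "\<lambda>k. phi \<sigma> (real n * fst x - of_int k)"
        and v = "\<lambda>k. phi \<sigma> (real n * snd x - of_int k)"
        and h = "\<lambda>a b. f (of_int a / real n, of_int b / real n) - f x"
        and A' = ?A and B' = ?B])
    show "0 < \<sigma> 1 - 1 / 2"
      using concave_sigmoidal_one_gt_half[OF sigma(2-4)] by simp
  qed (assumption | rule same phi_nonneg phi_mass sum_phi_tail_le sigma grid_point_difference_le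
      finite_atLeastAtMost_int Collect_restrict | simp)+
qed

end

section \<open>From pointwise bounds to the norm\<close>

text \<open>After division by \<open>a + b\<close> both fractions lie in \<open>[0, 1]\<close>, where \<open>t \<le> t powr q\<close>.\<close>

lemma powr_add_le_add_powr:
  fixes a b q :: real
  assumes "0 \<le> a" and "0 \<le> b" and "0 < q" and "q \<le> 1"
  shows "(a + b) powr q \<le> a powr q + b powr q"
proof (cases "a + b = 0")
  case False
  then have s: "0 < a + b" using assms by linarith
  have frac: "t \<le> t powr q" if "0 \<le> t" "t \<le> 1" for t :: real
    using powr_mono'[of q 1 t] that assms by auto
  have "1 = a / (a + b) + b / (a + b)" using s by (simp flip: add_divide_distrib)
  also have "\<dots> \<le> (a / (a + b)) powr q + (b / (a + b)) powr q"
    using s assms by (intro add_mono frac) auto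
  also have "\<dots> = (a powr q + b powr q) / (a + b) powr q"
    using s assms by (simp add: powr_divide add_divide_distrib)
  finally show ?thesis using s by (simp add: field_simps)
qed (use assms in auto)

text \<open>The integrand is dominated by the constant \<open>e powr p\<close> plus \<open>c powr p\<close> times the indicator
  of \<open>B\<close>. The bound also gives \<open>p\<close>-integrability, since \<open>S\<close> has finite measure.\<close>

lemma Lp_norm_le_off_small_set:
  fixes g :: "real \<times> real \<Rightarrow> real" and c e p :: real
  assumes p: "1 \<le> p" and g: "g \<in> borel_measurable (lebesgue_on S)"
    and S: "S \<in> lmeasurable" and B: "B \<in> lmeasurable"
    and c: "\<And>x. x \<in> S \<Longrightarrow> \<bar>g x\<bar> \<le> c" and e: "\<And>x. x \<in> S - B \<Longrightarrow> \<bar>g x\<bar> \<le> e"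
    and nonneg: "0 \<le> c" "0 \<le> e"
  shows "Lp_norm p S g \<le>
    ennreal (e * measure lebesgue S powr (1 / p) + c * measure lebesgue B powr (1 / p))"
proof -
  interpret finite_measure "lebesgue_on S"
    by (rule finite_measure_lebesgue_on[OF S])
  have gp: "(\<lambda>x. \<bar>g x\<bar> powr p) \<in> borel_measurable (lebesgue_on S)"
    using g by measurable
  have int: "integrable (lebesgue_on S) (\<lambda>x. \<bar>g x\<bar> powr p)"
    by (rule integrable_const_bound[of _ "c powr p"])
      (use p c gp in \<open>auto intro!: AE_I2 powr_mono2\<close>)
  have BS: "B \<inter> S \<in> sets (lebesgue_on S)"
    using B S by (auto simp: sets_restrict_space)
  have ind: "integrable (lebesgue_on S) (\<lambda>x. c powr p * indicator (B \<inter> S) x)"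
    using BS by (intro integrable_mult_right integrable_real_indicator) (auto simp: less_top[symmetric])
  then have int': "integrable (lebesgue_on S) (\<lambda>x. e powr p + c powr p * indicator (B \<inter> S) x)"
    by (intro Bochner_Integration.integrable_add integrable_const)
  let ?I = "integral\<^sup>L (lebesgue_on S) (\<lambda>x. \<bar>g x\<bar> powr p)"
  have "?I \<le> integral\<^sup>L (lebesgue_on S) (\<lambda>x. e powr p + c powr p * indicator (B \<inter> S) x)"
  proof (rule integral_mono[OF int int'])
    fix x assume "x \<in> space (lebesgue_on S)"
    then have x: "x \<in> S" by simp
    show "\<bar>g x\<bar> powr p \<le> e powr p + c powr p * indicator (B \<inter> S) x"
      using p x powr_mono2[of p "\<bar>g x\<bar>" e] powr_mono2[of p "\<bar>g x\<bar>" c] c[of x] e[of x]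
      by (cases "x \<in> B") (auto intro: add_increasing)
  qed
  also have "\<dots> = e powr p * measure lebesgue S + c powr p * measure lebesgue (B \<inter> S)"
    using BS S B ind by (subst Bochner_Integration.integral_add)
      (auto simp: measure_restrict_space Int_absorb1 Int_absorb2 mult.commute)
  also have "\<dots> \<le> e powr p * measure lebesgue S + c powr p * measure lebesgue B"
    using B S by (intro add_left_mono mult_left_mono measure_mono_fmeasurable) auto
  finally have "?I powr (1 / p) \<le> (e powr p * measure lebesgue S + c powr p * measure lebesgue B) powr (1 / p)"
    using p by (intro powr_mono2) auto
  also have "\<dots> \<le> (e powr p * measure lebesgue S) powr (1 / p) + (c powr p * measure lebesgue B) powr (1 / p)"
    using p by (intro powr_add_le_add_powr) auto
  also have "\<dots> = e * measure lebesgue S powr (1 / p) + c * measure lebesgue B powr (1 / p)"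
    using p nonneg by (simp add: powr_mult powr_powr)
  finally show ?thesis
    using g int by (simp add: Lp_norm_def ennreal_leI)
qed

theorem theorem7:
  fixes p \<alpha> \<nu> \<theta> :: real and \<sigma> :: "real \<Rightarrow> real" and N M :: nat
  assumes "1 \<le> p"
    and "mono \<sigma>" and "sigmoidal \<sigma>"
    and "odd_function (\<lambda>x. \<sigma> x - 1 / 2)"
    and "C2_real \<sigma>" and "concave_on {0..} \<sigma>"
    and "\<alpha> > p" and "\<sigma> \<in> O[at_bot](\<lambda>x. \<bar>x\<bar> powr (- 1 - \<alpha>))"
    and "N > 0" and "M > 0"
    and "0 < \<nu>" and "\<nu> < \<alpha>" and "0 < \<theta>" and "\<theta> < 1"
  shows "\<exists>K\<^sub>2::real. K\<^sub>2 > 0 \<and>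
    (\<forall>f. digital_image N M f \<longrightarrow> (\<forall>n::nat. n > 0 \<longrightarrow>
      Lp_norm p (image_domain N M) (\<lambda>x. nn_operator \<sigma> N M n f x - f x)
        \<le> ennreal (255 * (2 powr (p - 1) * real M * real N) powr (1 / p) *
            (K\<^sub>2 / real n powr (\<nu> * (1 - \<theta>) / p) + 8 powr (1 / p) / real n powr (\<theta> / p)))))"
proof -
  define D where "D = \<sigma> 1 - 1 / 2"
  have D: "0 < D"
    using concave_sigmoidal_one_gt_half[OF assms(3,4,6)] by (simp add: D_def)
  obtain C where C: "0 < C" "\<And>R. 1 \<le> R \<Longrightarrow> \<sigma> (1 - R) \<le> C * R powr (- \<nu>)"
    using sigmoidal_decay[OF assms(2,3), of "1 + \<alpha>" \<nu>] assms(8,11,12) by auto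
  (* The constant collects the factors of the tail estimate: two coordinates with total tail weight
     2 \<sigma> (1 - R) each, relative to total weight at least D. *)
  define K where "K = 4 * C / D"
  define V where "V = real M * real N"
  have V: "0 < V" using assms(9,10) by (simp add: V_def)
  have bound: "Lp_norm p (image_domain N M) (\<lambda>x. nn_operator \<sigma> N M n f x - f x)
        \<le> ennreal (255 * (2 powr (p - 1) * real M * real N) powr (1 / p) *
            (K / real n powr (\<nu> * (1 - \<theta>) / p) + 8 powr (1 / p) / real n powr (\<theta> / p)))"
    if f: "digital_image N M f" and n: "n > 0" for f and n :: nat
  proof -
    have n1: "1 \<le> real n" using n by simp
    define \<delta> where "\<delta> = real n powr (- \<theta>)"
    have \<delta>: "0 \<le> \<delta>" by (simp add: \<delta>_def)
    (* The strip width in grid units, which is the cut-off distance of the tails. *)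
    have R: "real n * \<delta> = real n powr (1 - \<theta>)"
      using n by (simp add: \<delta>_def powr_diff powr_minus field_simps)
    define e where "e = 255 * (K / real n powr (\<nu> * (1 - \<theta>)))"
    have "1 \<le> real n powr (1 - \<theta>)"
      using n1 assms(14) by (intro ge_one_powr_ge_zero) auto
    then have "\<sigma> (1 - real n * \<delta>) \<le> C * (real n powr (1 - \<theta>)) powr (- \<nu>)"
      unfolding R by (rule C(2))
    also have "\<dots> = C / real n powr (\<nu> * (1 - \<theta>))"
      by (simp add: powr_powr powr_minus divide_inverse algebra_simps flip: powr_minus)
    finally have "255 * (4 / D) * \<sigma> (1 - real n * \<delta>) \<le> 255 * (4 / D) * (C / real n powr (\<nu> * (1 - \<theta>)))"
      using D by (intro mult_left_mono) auto
    then have tail: "255 * (2 * (2 * \<sigma> (1 - real n * \<delta>)) / (\<sigma> 1 - 1 / 2)) \<le> e"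
      by (simp add: e_def K_def flip: D_def)
    have vol: "measure lebesgue (image_domain N M) = V"
      by (simp add: image_domain_def measure_box V_def)
    have "Lp_norm p (image_domain N M) (\<lambda>x. nn_operator \<sigma> N M n f x - f x) \<le>
      ennreal (e * measure lebesgue (image_domain N M) powr (1 / p)
        + 255 * measure lebesgue (edge_region N M \<delta>) powr (1 / p))"
    proof (rule Lp_norm_le_off_small_set)
      show "(\<lambda>x. nn_operator \<sigma> N M n f x - f x) \<in> borel_measurable (lebesgue_on (image_domain N M))"
        by (intro borel_measurable_diff nn_operator_measurable digital_image_measurable assms f)
      show "image_domain N M \<in> lmeasurable"
        by (simp add: image_domain_def box_lmeasurable)
      show "\<bar>nn_operator \<sigma> N M n f x - f x\<bar> \<le> 255" if "x \<in> image_domain N M" for x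
        by (intro nn_operator_error_le assms f n that)
      show "\<bar>nn_operator \<sigma> N M n f x - f x\<bar> \<le> e"
        if "x \<in> image_domain N M - edge_region N M \<delta>" for x
        by (rule order_trans[OF nn_operator_error_off_edges tail]) (use that assms f n in auto)
    qed (use assms(1) \<delta> C D in \<open>auto simp: e_def K_def edge_region_lmeasurable\<close>)
    also have "\<dots> \<le> ennreal (255 * (2 powr (p - 1) * real M * real N) powr (1 / p) *
            (K / real n powr (\<nu> * (1 - \<theta>) / p) + 8 powr (1 / p) / real n powr (\<theta> / p)))"
    proof (rule ennreal_leI)
      have "measure lebesgue (edge_region N M \<delta>) powr (1 / p) \<le> (8 * \<delta> * V) powr (1 / p)"
        (* The area 4 \<delta> V is relaxed to 8 \<delta> V to match the constant in the statement. *)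
        using measure_edge_region_le[OF \<delta>, of N M] assms(1) \<delta> V
        by (intro powr_mono2) (auto simp: V_def algebra_simps intro: order_trans)
      also have "\<dots> = V powr (1 / p) * (8 powr (1 / p) / real n powr (\<theta> / p))"
        using V by (simp add: \<delta>_def powr_mult powr_powr powr_minus_divide powr_divide)
      finally have 1: "measure lebesgue (edge_region N M \<delta>) powr (1 / p) \<le>
        V powr (1 / p) * (8 powr (1 / p) / real n powr (\<theta> / p))" .
      have "\<nu> * (1 - \<theta>) / p \<le> \<nu> * (1 - \<theta>)"
        using divide_left_mono[of 1 p "\<nu> * (1 - \<theta>)"] assms(1,11,14) by simp
      then have 2: "e \<le> 255 * (K / real n powr (\<nu> * (1 - \<theta>) / p))"
        using n1 C D unfolding e_def K_def
        by (intro mult_left_mono divide_left_mono powr_mono) auto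
      have "1 \<le> (2::real) powr (p - 1)"
        using assms(1) by (intro ge_one_powr_ge_zero) auto
      then have "V \<le> 2 powr (p - 1) * real M * real N"
        using V mult_right_mono[of 1 "2 powr (p - 1)" V] by (simp add: V_def mult.assoc)
      then have 3: "V powr (1 / p) \<le> (2 powr (p - 1) * real M * real N) powr (1 / p)"
        using V assms(1) by (intro powr_mono2) auto
      have "e * V powr (1 / p) + 255 * measure lebesgue (edge_region N M \<delta>) powr (1 / p) \<le>
        255 * (K / real n powr (\<nu> * (1 - \<theta>) / p)) * V powr (1 / p)
        + 255 * (V powr (1 / p) * (8 powr (1 / p) / real n powr (\<theta> / p)))"
        using 1 2 by (intro add_mono mult_right_mono mult_left_mono) auto
      also have "\<dots> = 255 * V powr (1 / p) *
          (K / real n powr (\<nu> * (1 - \<theta>) / p) + 8 powr (1 / p) / real n powr (\<theta> / p))"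
        by (simp add: algebra_simps)
      also have "\<dots> \<le> 255 * (2 powr (p - 1) * real M * real N) powr (1 / p) *
          (K / real n powr (\<nu> * (1 - \<theta>) / p) + 8 powr (1 / p) / real n powr (\<theta> / p))"
        using 3 C D by (intro mult_right_mono mult_left_mono) (auto simp: K_def)
      finally show "e * measure lebesgue (image_domain N M) powr (1 / p)
        + 255 * measure lebesgue (edge_region N M \<delta>) powr (1 / p) \<le>
        255 * (2 powr (p - 1) * real M * real N) powr (1 / p) *
          (K / real n powr (\<nu> * (1 - \<theta>) / p) + 8 powr (1 / p) / real n powr (\<theta> / p))"
        unfolding vol .
    qed
    finally show ?thesis .
  qed
  have "0 < K" using C D by (simp add: K_def)
  with bound show ?thesis by blast
qed

end
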